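(* Let $\mathcal E$ be a category and $\mathcal F\subseteq\mathcal E$ a subcategory with the same objects, and let $[\mathcal F]$ be the domination closure of $\mathcal F$ in $\mathcal E$. Then (i) $[\mathcal F]$ is a category and $\mathcal F$ is dominating in $[\mathcal F]$; in particular $\mathcal F\subseteq[\mathcal F]$; and (ii) $[[\mathcal F]]=[\mathcal F]$ (domination closures taken in $\mathcal E$).
   Context: For a set $X$ of morphisms of $\mathcal E$, $\mathcal F$ is dominating in $X$ if (i) $g\circ f\in X$ for all $f\in\mathcal F$ and $g\in X$ with $\mathrm{codom}(f)=\mathrm{dom}(g)$, and (ii) for every $g'\in X$ there is $g''\in X$ with $g'\circ g''$ defined and in $\mathcal F$. The domination closure $[\mathcal F]$ of $\mathcal F$ in $\mathcal E$ is the union of all sets $X\subseteq\mathcal E$ in which $\mathcal F$ is dominating. For a subcategory $\mathcal F'$ of $\mathcal E$ with the same objects, $[\mathcal F']$ is defined in the same way. *)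

theory Defs
  imports Main
begin

record ('o, 'm) cat =
  Obj :: "'o set"
  Mor :: "'m set"
  Dom :: "'m \<Rightarrow> 'o"
  Cod :: "'m \<Rightarrow> 'o"
  Ident :: "'o \<Rightarrow> 'm"
  Comp :: "'m \<Rightarrow> 'm \<Rightarrow> 'm"  (infixl "\<cdot>\<index>" 70)

text \<open>\<open>g \<cdot> f\<close> is ``first \<open>f\<close>, then \<open>g\<close>''; its value is
  meaningful only for morphisms with \<open>Cod f = Dom g\<close>.\<close>

locale category =
  fixes C :: "('o, 'm) cat" (structure)
  assumes Dom_in_Obj: "f \<in> Mor C \<Longrightarrow> Dom C f \<in> Obj C"
    and Cod_in_Obj: "f \<in> Mor C \<Longrightarrow> Cod C f \<in> Obj C"
    and Ident_in_Mor: "a \<in> Obj C \<Longrightarrow> Ident C a \<in> Mor C"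
    and Dom_Ident: "a \<in> Obj C \<Longrightarrow> Dom C (Ident C a) = a"
    and Cod_Ident: "a \<in> Obj C \<Longrightarrow> Cod C (Ident C a) = a"
    and Comp_in_Mor: "\<lbrakk>f \<in> Mor C; g \<in> Mor C; Cod C f = Dom C g\<rbrakk> \<Longrightarrow> g \<cdot> f \<in> Mor C"
    and Dom_Comp: "\<lbrakk>f \<in> Mor C; g \<in> Mor C; Cod C f = Dom C g\<rbrakk> \<Longrightarrow> Dom C (g \<cdot> f) = Dom C f"
    and Cod_Comp: "\<lbrakk>f \<in> Mor C; g \<in> Mor C; Cod C f = Dom C g\<rbrakk> \<Longrightarrow> Cod C (g \<cdot> f) = Cod C g"
    and Comp_Ident_right: "f \<in> Mor C \<Longrightarrow> f \<cdot> Ident C (Dom C f) = f"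
    and Comp_Ident_left: "f \<in> Mor C \<Longrightarrow> Ident C (Cod C f) \<cdot> f = f"
    and Comp_assoc: "\<lbrakk>f \<in> Mor C; g \<in> Mor C; h \<in> Mor C; Cod C f = Dom C g; Cod C g = Dom C h\<rbrakk>
      \<Longrightarrow> (h \<cdot> g) \<cdot> f = h \<cdot> (g \<cdot> f)"

definition subcategory :: "('o, 'm) cat \<Rightarrow> ('o, 'm) cat \<Rightarrow> bool" where
  "subcategory D C \<longleftrightarrow>
     category D \<and> category C \<and> Obj D \<subseteq> Obj C \<and> Mor D \<subseteq> Mor C \<and>
     (\<forall>f\<in>Mor D. Dom D f = Dom C f \<and> Cod D f = Cod C f) \<and>
     (\<forall>a\<in>Obj D. Ident D a = Ident C a) \<and>
     (\<forall>f\<in>Mor D. \<forall>g\<in>Mor D. Cod C f = Dom C g \<longrightarrow> g \<cdot>\<^bsub>D\<^esub> f = g \<cdot>\<^bsub>C\<^esub> f)"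

definition dominating_in :: "('o, 'm) cat \<Rightarrow> 'm set \<Rightarrow> 'm set \<Rightarrow> bool" where
  "dominating_in E F X \<longleftrightarrow>
     (\<forall>f\<in>F. \<forall>g\<in>X. Cod E f = Dom E g \<longrightarrow> g \<cdot>\<^bsub>E\<^esub> f \<in> X) \<and>
     (\<forall>g'\<in>X. \<exists>g''\<in>X. Cod E g'' = Dom E g' \<and> g' \<cdot>\<^bsub>E\<^esub> g'' \<in> F)"

definition domination_closure :: "('o, 'm) cat \<Rightarrow> 'm set \<Rightarrow> 'm set" where
  "domination_closure E F = \<Union>{X. X \<subseteq> Mor E \<and> dominating_in E F X}"

text \<open>The structure with the objects of \<open>E\<close>, the morphisms in \<open>X\<close>, and domain, codomain,
  identities and composition inherited from \<open>E\<close>; in general it need not be a category.\<close>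

definition restrict_Mor :: "('o, 'm) cat \<Rightarrow> 'm set \<Rightarrow> ('o, 'm) cat" where
  "restrict_Mor E X = E\<lparr>Mor := X\<rparr>"

end

theory Submission
  imports Defs
begin

text \<open>Condition (ii) can be iterated: if \<open>g\<close> and \<open>h\<close> lie in \<open>[F]\<close>, choose \<open>g''\<close> in \<open>[F]\<close> with
  \<open>g g''\<close> in \<open>F\<close>; then \<open>h (g g'')\<close> lies in \<open>[F]\<close> by (i), so some \<open>k\<close> in \<open>[F]\<close> has
  \<open>h g (g'' k)\<close> in \<open>F\<close>. Hence \<open>F\<close> is dominating in the set of composites of members of
  \<open>[F]\<close>, which is therefore contained in \<open>[F]\<close>. The same two-step choice shows that \<open>F\<close> is
  dominating in \<open>[[F]]\<close>.\<close>

lemma dominating_in_compD: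
  "\<lbrakk>dominating_in E F X; f \<in> F; g \<in> X; Cod E f = Dom E g\<rbrakk> \<Longrightarrow> g \<cdot>\<^bsub>E\<^esub> f \<in> X"
  unfolding dominating_in_def by blast

lemma dominating_in_exE:
  assumes "dominating_in E F X" "g \<in> X"
  obtains g' where "g' \<in> X" "Cod E g' = Dom E g" "g \<cdot>\<^bsub>E\<^esub> g' \<in> F"
  using assms unfolding dominating_in_def by blast

lemma domination_closure_subset_Mor: "domination_closure E F \<subseteq> Mor E"
  unfolding domination_closure_def by blast

lemma domination_closure_upper:
  "\<lbrakk>X \<subseteq> Mor E; dominating_in E F X\<rbrakk> \<Longrightarrow> X \<subseteq> domination_closure E F"
  unfolding domination_closure_def by blast

text \<open>Both conditions pass to unions: each starts from a single member of some
  \<open>X\<close>, and the composite in (i) or the witness in (ii) can be found in that same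
  \<open>X\<close>.\<close>

lemma dominating_in_domination_closure: "dominating_in E F (domination_closure E F)"
  unfolding domination_closure_def dominating_in_def by blast

context category
begin

text \<open>Such an \<open>F\<close> is dominating in itself, with the identity at
  \<open>Dom C g\<close> as the witness for \<open>g\<close> in (ii). The lemma serves twice: for
  the given subcategory and for its closure.\<close>

lemma subset_domination_closure:
  assumes "F \<subseteq> Mor C"
    and "\<And>a. a \<in> Obj C \<Longrightarrow> Ident C a \<in> F"
    and "\<And>f g. \<lbrakk>f \<in> F; g \<in> F; Cod C f = Dom C g\<rbrakk> \<Longrightarrow> g \<cdot> f \<in> F"
  shows "F \<subseteq> domination_closure C F"
proof (rule domination_closure_upper[OF assms(1)])
  have "\<exists>g'\<in>F. Cod C g' = Dom C g \<and> g \<cdot> g' \<in> F" if "g \<in> F" for g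
  proof -
    have "g \<in> Mor C" using that assms(1) by blast
    then show ?thesis
      using that assms(2) by (metis Cod_Ident Comp_Ident_right Dom_in_Obj)
  qed
  then show "dominating_in C F F"
    unfolding dominating_in_def using assms(3) by blast
qed

lemma Comp_in_domination_closure:
  assumes F: "F \<subseteq> Mor C"
    and g: "g \<in> domination_closure C F" and h: "h \<in> domination_closure C F"
    and gh: "Cod C g = Dom C h"
  shows "h \<cdot> g \<in> domination_closure C F"
proof -
  define D where "D = domination_closure C F"
  define X where "X = {h \<cdot> g | g h. g \<in> D \<and> h \<in> D \<and> Cod C g = Dom C h}"
  have D: "D \<subseteq> Mor C" and dom: "dominating_in C F D"
    unfolding D_def by (rule domination_closure_subset_Mor dominating_in_domination_closure)+
  have "X \<subseteq> Mor C"
    using D unfolding X_def by (blast intro: Comp_in_Mor)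
  moreover have "x \<cdot> f \<in> X" if f: "f \<in> F" and x: "x \<in> X" and fx: "Cod C f = Dom C x" for f x
  proof -
    obtain g h where gh: "x = h \<cdot> g" "g \<in> D" "h \<in> D" "Cod C g = Dom C h"
      using x unfolding X_def by blast
    have M: "f \<in> Mor C" "g \<in> Mor C" "h \<in> Mor C" using f F gh D by blast+
    have fg: "Cod C f = Dom C g" using fx gh M by (simp add: Dom_Comp)
    \<comment> \<open>The right factor absorbs \<open>f\<close>, so the result is again a composite
      of two members of \<open>D\<close>.\<close>
    have "x \<cdot> f = h \<cdot> (g \<cdot> f)" using gh M fg by (simp add: Comp_assoc)
    moreover have "g \<cdot> f \<in> D" by (rule dominating_in_compD[OF dom f gh(2) fg])
    moreover have "Cod C (g \<cdot> f) = Dom C h" using gh M fg by (simp add: Cod_Comp)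
    ultimately show ?thesis using gh(3) unfolding X_def by blast
  qed
  moreover have "\<exists>y\<in>X. Cod C y = Dom C x \<and> x \<cdot> y \<in> F" if x: "x \<in> X" for x
  proof -
    obtain g h where gh: "x = h \<cdot> g" "g \<in> D" "h \<in> D" "Cod C g = Dom C h"
      using x unfolding X_def by blast
    obtain g' where g': "g' \<in> D" "Cod C g' = Dom C g" "g \<cdot> g' \<in> F"
      using dominating_in_exE[OF dom gh(2)] .
    have M: "g \<in> Mor C" "h \<in> Mor C" "g' \<in> Mor C" using gh g' D by blast+
    have "h \<cdot> (g \<cdot> g') \<in> D"
      using dominating_in_compD[OF dom g'(3) gh(3)] gh g' M by (simp add: Cod_Comp)
    then obtain k where k: "k \<in> D" "Cod C k = Dom C (h \<cdot> (g \<cdot> g'))" "h \<cdot> (g \<cdot> g') \<cdot> k \<in> F"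
      using dominating_in_exE[OF dom] by blast
    have kM: "k \<in> Mor C" using k D by blast
    have kg': "Cod C k = Dom C g'"
      using k(2) gh g' M by (simp add: Dom_Comp Cod_Comp Comp_in_Mor)
    have "x \<cdot> (g' \<cdot> k) = h \<cdot> (g \<cdot> g') \<cdot> k"
      using gh g' M kM kg' by (simp add: Comp_assoc Dom_Comp Cod_Comp Comp_in_Mor)
    \<comment> \<open>The witness need only lie in \<open>X\<close>, not in \<open>D\<close>, so two
      successive choices from \<open>D\<close> suffice. This is why (ii) is checked in the set of
      composites.\<close>
    moreover have "g' \<cdot> k \<in> X" using g'(1) k(1) kg' unfolding X_def by blast
    moreover have "Cod C (g' \<cdot> k) = Dom C x"
      using gh g' M kM kg' by (simp add: Dom_Comp Cod_Comp)
    ultimately show ?thesis using k(3) by metis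
  qed
  ultimately have "X \<subseteq> D"
    unfolding D_def by (intro domination_closure_upper) (auto simp: dominating_in_def)
  moreover have "h \<cdot> g \<in> X"
    using g h gh unfolding X_def D_def by blast
  ultimately show ?thesis unfolding D_def by blast
qed

lemma domination_closure_idem_subset:
  assumes sub: "F \<subseteq> domination_closure C F"
  shows "domination_closure C (domination_closure C F) \<subseteq> domination_closure C F"
proof -
  define D where "D = domination_closure C F"
  define D2 where "D2 = domination_closure C D"
  have D: "D \<subseteq> Mor C" and dom: "dominating_in C F D"
    and D2: "D2 \<subseteq> Mor C" and dom2: "dominating_in C D D2"
    unfolding D_def D2_def
    by (rule domination_closure_subset_Mor dominating_in_domination_closure)+
  have "\<exists>y\<in>D2. Cod C y = Dom C x \<and> x \<cdot> y \<in> F" if x: "x \<in> D2" for x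
  proof -
    obtain y where y: "y \<in> D2" "Cod C y = Dom C x" "x \<cdot> y \<in> D"
      using dominating_in_exE[OF dom2 x] .
    obtain k where k: "k \<in> D" "Cod C k = Dom C (x \<cdot> y)" "x \<cdot> y \<cdot> k \<in> F"
      using dominating_in_exE[OF dom y(3)] .
    have M: "x \<in> Mor C" "y \<in> Mor C" "k \<in> Mor C" using x y k D D2 by blast+
    have ky: "Cod C k = Dom C y" using k y M by (simp add: Dom_Comp)
    \<comment> \<open>The correction \<open>k\<close> that brings \<open>x \<cdot> y\<close> into
      \<open>F\<close> comes from \<open>D\<close>, and \<open>D2\<close> is stable under
      precomposition with members of \<open>D\<close>.\<close>
    have "y \<cdot> k \<in> D2" by (rule dominating_in_compD[OF dom2 k(1) y(1) ky])
    moreover have "Cod C (y \<cdot> k) = Dom C x" using y M ky by (simp add: Cod_Comp)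
    moreover have "x \<cdot> (y \<cdot> k) \<in> F" using k(3) y M ky by (simp add: Comp_assoc)
    ultimately show ?thesis by blast
  qed
  moreover have "x \<cdot> f \<in> D2" if "f \<in> F" "x \<in> D2" "Cod C f = Dom C x" for f x
    using dominating_in_compD[OF dom2] that sub unfolding D_def by blast
  ultimately have "dominating_in C F D2"
    unfolding dominating_in_def by blast
  then show ?thesis
    using domination_closure_upper[OF D2] unfolding D_def D2_def by blast
qed

text \<open>The equational laws are inherited by any set of morphisms; only the existence of
  identities and composites has to be supplied.\<close>

lemma subcategory_restrict_Mor:
  assumes X: "X \<subseteq> Mor C"
    and ids: "\<And>a. a \<in> Obj C \<Longrightarrow> Ident C a \<in> X"
    and comps: "\<And>f g. \<lbrakk>f \<in> X; g \<in> X; Cod C f = Dom C g\<rbrakk> \<Longrightarrow> g \<cdot> f \<in> X"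
  shows "subcategory (restrict_Mor C X) C"
proof -
  note M = subsetD[OF X]
  have "category (restrict_Mor C X)"
    by unfold_locales
      (auto simp: restrict_Mor_def ids comps M Dom_in_Obj Cod_in_Obj Dom_Ident Cod_Ident Dom_Comp
        Cod_Comp Comp_Ident_right Comp_Ident_left Comp_assoc)
  then show ?thesis
    using X category_axioms by (simp add: subcategory_def restrict_Mor_def)
qed

end

theorem theorem4p2:
  fixes E F :: "('o, 'm) cat"
  assumes "category E"
    and "subcategory F E"
    and "Obj F = Obj E"
  shows "subcategory (restrict_Mor E (domination_closure E (Mor F))) E \<and>
         dominating_in E (Mor F) (domination_closure E (Mor F)) \<and>
         Mor F \<subseteq> domination_closure E (Mor F) \<and>
         domination_closure E (domination_closure E (Mor F)) = domination_closure E (Mor F)"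
proof -
  interpret E: category E by fact
  interpret F: category F using assms(2) by (simp add: subcategory_def)
  let ?D = "domination_closure E (Mor F)"
  have FM: "Mor F \<subseteq> Mor E" using assms(2) by (simp add: subcategory_def)
  \<comment> \<open>Equality of the object sets enters here: every identity of \<open>E\<close> is
    an identity of \<open>F\<close>.\<close>
  have F_ids: "Ident E a \<in> Mor F" if "a \<in> Obj E" for a
    using that assms(2,3) F.Ident_in_Mor[of a] by (simp add: subcategory_def)
  have F_comps: "g \<cdot>\<^bsub>E\<^esub> f \<in> Mor F" if "f \<in> Mor F" "g \<in> Mor F" "Cod E f = Dom E g" for f g
    using that assms(2) F.Comp_in_Mor[of f g] by (simp add: subcategory_def)
  have FD: "Mor F \<subseteq> ?D"
    by (rule E.subset_domination_closure[OF FM F_ids F_comps])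
  have D_ids: "Ident E a \<in> ?D" if "a \<in> Obj E" for a
    using F_ids[OF that] FD by blast
  note D_comps = E.Comp_in_domination_closure[OF FM]
  \<comment> \<open>The closure now satisfies the conditions that gave \<open>FD\<close>, so the
    same argument yields this half of idempotence.\<close>
  have "?D \<subseteq> domination_closure E ?D"
    by (rule E.subset_domination_closure[OF domination_closure_subset_Mor D_ids D_comps])
  moreover have "subcategory (restrict_Mor E ?D) E"
    by (rule E.subcategory_restrict_Mor[OF domination_closure_subset_Mor D_ids D_comps])
  ultimately show ?thesis
    using FD E.domination_closure_idem_subset[OF FD] dominating_in_domination_closure by blast
qed

end
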